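(* Let $\gamma$ be the forward unit speed geodesic in the Funk disc $(\mathbb{D},F_F)$ with initial point $p\in\mathbb{D}$ and forward hitting point $y\in\partial\mathbb{D}$, and let $b_\gamma$ be its forward Busemann function. Then: (1) $\displaystyle\overrightarrow{\Delta}_{HT}\,b_\gamma(x)=\overrightarrow{\Delta}_{BH}\,b_\gamma(x)+\frac{3(\langle x,y\rangle-|x|^2)}{1-|x|^2}$ for all $x\in\mathbb{D}$; (2) $\displaystyle\overrightarrow{\Delta}_{\max}\,b_\gamma(x)=\overrightarrow{\Delta}_{BH}\,b_\gamma(x)+\frac{3(\langle x,y\rangle-|x|^2)}{|x|(1-|x|^2)}$ for all $x\in\mathbb{D}\setminus\{0\}$; (3) $\displaystyle\overrightarrow{\Delta}_{\min}\,b_\gamma(x)=\overrightarrow{\Delta}_{BH}\,b_\gamma(x)-\frac{3(\langle x,y\rangle-|x|^2)}{|x|(1-|x|^2)}$ for all $x\in\mathbb{D}\setminus\{0\}$.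
   Context: $\mathbb{D}=\{x\in\mathbb{R}^2:|x|<1\}$, with $|\cdot|$ and $\langle\cdot,\cdot\rangle$ the Euclidean norm and inner product. The Funk metric is $F=F_F=\alpha+\beta$ with $\alpha(x,v)=\dfrac{\sqrt{(1-|x|^2)|v|^2+\langle x,v\rangle^2}}{1-|x|^2}=\sqrt{a_{ij}(x)v^iv^j}$ and $\beta(x,v)=\dfrac{\langle x,v\rangle}{1-|x|^2}$. Its (asymmetric) distance is $d_F(x_1,x_2)=\ln\dfrac{|x_1-a|}{|x_2-a|}$ for $x_1\neq x_2$, where $a$ is the point at which the ray from $x_1$ through $x_2$ meets $\partial\mathbb{D}$ (and $d_F(x,x)=0$). The forward geodesic is $\gamma(t)=e^{-t}p+(1-e^{-t})y$, $t\ge0$, and $b_\gamma(x)=\lim_{t\to\infty}\{t-d_F(x,\gamma(t))\}$. The dual metric is $F^*(x,\xi)=\sup_{F(x,v)=1}\xi(v)$, $\xi\in T_x^*\mathbb{D}$, and $g^{*ij}(x,\xi)=\dfrac12\dfrac{\partial^2[F^{*2}]}{\partial\xi_i\partial\xi_j}(x,\xi)$ for $\xi\neq0$. For a volume density $\sigma_\mu$, the forward Shen Laplacian of a $C^2$ function $f$ is, at points where $df_x\neq0$, $$\overrightarrow{\Delta}_\mu f(x)=\frac{1}{\sigma_\mu(x)}\frac{\partial}{\partial x^i}\Big(\sigma_\mu(x)\,g^{*ij}(x,df_x)\frac{\partial f}{\partial x^j}(x)\Big)$$ (summation over repeated indices). With $n=2$, $\|\beta\|_\alpha=\sqrt{a^{ij}b_ib_j}$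 (where $\beta=b_idx^i$; here $\|\beta\|_\alpha=|x|$) and $\sigma_\alpha=\sqrt{\det(a_{ij})}=(1-|x|^2)^{-3/2}$, the densities for the Busemann-Hausdorff, Holmes-Thompson, maximum and minimum volume forms are $\sigma_{BH}=(1-\|\beta\|_\alpha^2)^{\frac{n+1}{2}}\sigma_\alpha=1$, $\ \sigma_{HT}=\sigma_\alpha$, $\ \sigma_{\max}=(1+\|\beta\|_\alpha)^{n+1}\sigma_\alpha=\left(\dfrac{1+|x|}{1-|x|}\right)^{3/2}$, $\ \sigma_{\min}=(1-\|\beta\|_\alpha)^{n+1}\sigma_\alpha=\left(\dfrac{1-|x|}{1+|x|}\right)^{3/2}$. *)

theory Defs
  imports "HOL-Analysis.Analysis"
begin

text \<open>
  Points, tangent vectors and covectors of the disc are written in the standard coordinates of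
  \<^typ>\<open>real^2\<close>. A covector \<open>\<xi>\<close> is given by its components \<open>\<xi>\<^sub>i\<close>, so it acts on a tangent vector \<open>v\<close>
  by \<open>\<xi>(v) = \<xi> \<bullet> v\<close>.
\<close>

abbreviation disc :: "(real^2) set"
  where "disc \<equiv> ball 0 1"

definition funk_alpha :: "real^2 \<Rightarrow> real^2 \<Rightarrow> real"
  where "funk_alpha x v =
    sqrt ((1 - (norm x)\<^sup>2) * (norm v)\<^sup>2 + (x \<bullet> v)\<^sup>2) / (1 - (norm x)\<^sup>2)"

definition funk_beta :: "real^2 \<Rightarrow> real^2 \<Rightarrow> real"
  where "funk_beta x v = (x \<bullet> v) / (1 - (norm x)\<^sup>2)"

definition funk_metric :: "real^2 \<Rightarrow> real^2 \<Rightarrow> real"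
  where "funk_metric x v = funk_alpha x v + funk_beta x v"

definition ray_exit :: "real^2 \<Rightarrow> real^2 \<Rightarrow> real^2"
  where "ray_exit x\<^sub>1 x\<^sub>2 = (THE a. a \<in> sphere 0 1 \<and> (\<exists>s\<ge>0. a = x\<^sub>1 + s *\<^sub>R (x\<^sub>2 - x\<^sub>1)))"

definition funk_dist :: "real^2 \<Rightarrow> real^2 \<Rightarrow> real"
  where "funk_dist x\<^sub>1 x\<^sub>2 =
    (if x\<^sub>1 = x\<^sub>2 then 0
     else ln (norm (x\<^sub>1 - ray_exit x\<^sub>1 x\<^sub>2) / norm (x\<^sub>2 - ray_exit x\<^sub>1 x\<^sub>2)))"

definition funk_geodesic :: "real^2 \<Rightarrow> real^2 \<Rightarrow> real \<Rightarrow> real^2"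
  where "funk_geodesic p y t = exp (- t) *\<^sub>R p + (1 - exp (- t)) *\<^sub>R y"

definition busemann :: "(real \<Rightarrow> real^2) \<Rightarrow> real^2 \<Rightarrow> real"
  where "busemann \<gamma> x = Lim at_top (\<lambda>t. t - funk_dist x (\<gamma> t))"

definition partial_deriv :: "2 \<Rightarrow> (real^2 \<Rightarrow> real) \<Rightarrow> real^2 \<Rightarrow> real"
  where "partial_deriv i f x = deriv (\<lambda>h. f (x + h *\<^sub>R axis i 1)) 0"

definition differential :: "(real^2 \<Rightarrow> real) \<Rightarrow> real^2 \<Rightarrow> real^2"
  where "differential f x = (\<chi> i. partial_deriv i f x)"

definition dual_metric :: "(real^2 \<Rightarrow> real^2 \<Rightarrow> real) \<Rightarrow> real^2 \<Rightarrow> real^2 \<Rightarrow> real"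
  where "dual_metric F x \<xi> = (SUP v\<in>{v. F x v = 1}. \<xi> \<bullet> v)"

definition dual_tensor ::
    "(real^2 \<Rightarrow> real^2 \<Rightarrow> real) \<Rightarrow> real^2 \<Rightarrow> real^2 \<Rightarrow> 2 \<Rightarrow> 2 \<Rightarrow> real"
  where "dual_tensor F x \<xi> i j =
    1/2 * partial_deriv i (partial_deriv j (\<lambda>\<eta>. (dual_metric F x \<eta>)\<^sup>2)) \<xi>"

text \<open>Meaningful for \<open>f\<close> of class \<open>C\<^sup>2\<close> near \<open>x\<close> with nonvanishing differential at \<open>x\<close>.\<close>

definition shen_laplacian ::
    "(real^2 \<Rightarrow> real^2 \<Rightarrow> real) \<Rightarrow> (real^2 \<Rightarrow> real) \<Rightarrow> (real^2 \<Rightarrow> real) \<Rightarrow> real^2 \<Rightarrow> real"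
  where "shen_laplacian F \<sigma> f x =
    1 / \<sigma> x *
    (\<Sum>i\<in>UNIV. partial_deriv i
       (\<lambda>z. \<sigma> z * (\<Sum>j\<in>UNIV. dual_tensor F z (differential f z) i j * partial_deriv j f z)) x)"

definition alpha_matrix :: "real^2 \<Rightarrow> real^2^2"
  where "alpha_matrix x =
    (\<chi> i j. (if i = j then 1 else 0) / (1 - (norm x)\<^sup>2) + x $ i * x $ j / (1 - (norm x)\<^sup>2)\<^sup>2)"

definition beta_covector :: "real^2 \<Rightarrow> real^2"
  where "beta_covector x = (\<chi> i. x $ i / (1 - (norm x)\<^sup>2))"

definition beta_norm :: "real^2 \<Rightarrow> real"
  where "beta_norm x =
    sqrt (\<Sum>i\<in>UNIV. \<Sum>j\<in>UNIV.
      matrix_inv (alpha_matrix x) $ i $ j * beta_covector x $ i * beta_covector x $ j)"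

definition sigma_alpha :: "real^2 \<Rightarrow> real"
  where "sigma_alpha x = sqrt (det (alpha_matrix x))"

definition sigma_BH :: "real^2 \<Rightarrow> real"
  where "sigma_BH x = (1 - (beta_norm x)\<^sup>2) powr ((real CARD(2) + 1) / 2) * sigma_alpha x"

definition sigma_HT :: "real^2 \<Rightarrow> real"
  where "sigma_HT x = sigma_alpha x"

definition sigma_max :: "real^2 \<Rightarrow> real"
  where "sigma_max x = (1 + beta_norm x) ^ (CARD(2) + 1) * sigma_alpha x"

definition sigma_min :: "real^2 \<Rightarrow> real"
  where "sigma_min x = (1 - beta_norm x) ^ (CARD(2) + 1) * sigma_alpha x"

lemma norm2_real2: "(norm (x::real^2))\<^sup>2 = (x $ 1)\<^sup>2 + (x $ 2)\<^sup>2"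
  unfolding power2_norm_eq_inner by (simp add: inner_vec_def sum_2 power2_eq_square)

lemma disc_gap_pos: "x \<in> disc \<Longrightarrow> 0 < 1 - (norm (x::real^2))\<^sup>2"
  by (simp add: power_less_one_iff abs_square_less_1)

lemma funk_alpha_eq:
  assumes "x \<in> disc"
  shows "funk_alpha x v =
    sqrt (\<Sum>i\<in>UNIV. \<Sum>j\<in>UNIV. alpha_matrix x $ i $ j * v $ i * v $ j)"
proof -
  define s where "s = 1 - (norm x)\<^sup>2"
  have s: "s > 0" using disc_gap_pos[OF assms] by (simp add: s_def)
  have A: "alpha_matrix x $ i $ j = (if i = j then 1 else 0) / s + x $ i * x $ j / s\<^sup>2" for i j
    by (simp add: alpha_matrix_def s_def)
  have "(\<Sum>i\<in>UNIV. \<Sum>j\<in>UNIV. alpha_matrix x $ i $ j * v $ i * v $ j)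
      = (s * (norm v)\<^sup>2 + (x \<bullet> v)\<^sup>2) / s\<^sup>2"
    using s unfolding norm2_real2[of v]
    by (simp add: A sum_2 inner_vec_def field_simps power2_eq_square)
  then show ?thesis
    using s by (simp add: funk_alpha_def s_def[symmetric] real_sqrt_divide)
qed

lemma funk_beta_eq: "funk_beta x v = (\<Sum>i\<in>UNIV. beta_covector x $ i * v $ i)"
  by (simp add: funk_beta_def beta_covector_def sum_2 inner_vec_def add_divide_distrib)

lemma det_alpha_matrix:
  assumes "x \<in> disc"
  shows "det (alpha_matrix x) = 1 / (1 - (norm x)\<^sup>2) ^ 3"
proof -
  define s where "s = 1 - (norm x)\<^sup>2"
  have s: "s > 0" using disc_gap_pos[OF assms] by (simp add: s_def)
  have A: "alpha_matrix x $ i $ j = (if i = j then 1 else 0) / s + x $ i * x $ j / s\<^sup>2" for i j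
    by (simp add: alpha_matrix_def s_def)
  have r: "(x $ 2)\<^sup>2 = 1 - s - (x $ 1)\<^sup>2" by (simp add: s_def norm2_real2)
  have "det (alpha_matrix x) = (s + ((x $ 1)\<^sup>2 + (x $ 2)\<^sup>2)) / s ^ 3"
    using s by (simp add: det_2 A field_simps power2_eq_square power3_eq_cube)
  then show ?thesis by (simp add: r s_def)
qed

lemma sigma_alpha_eq:
  assumes "x \<in> disc"
  shows "sigma_alpha x = (1 - (norm x)\<^sup>2) powr (- 3 / 2)"
proof -
  have s: "0 < 1 - (norm x)\<^sup>2" by (rule disc_gap_pos[OF assms])
  have "1 / (1 - (norm x)\<^sup>2) ^ 3 = (1 - (norm x)\<^sup>2) powr (- 3)"
    using s by (simp add: powr_minus powr_numeral divide_inverse)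
  then show ?thesis
    using s by (simp add: sigma_alpha_def det_alpha_matrix[OF assms] powr_half_sqrt[symmetric]
        powr_powr)
qed

lemma beta_norm_eq:
  assumes "x \<in> disc"
  shows "beta_norm x = norm x"
proof -
  define s where "s = 1 - (norm x)\<^sup>2"
  have s: "s > 0" using disc_gap_pos[OF assms] by (simp add: s_def)
  have A: "alpha_matrix x $ i $ j = (if i = j then 1 else 0) / s + x $ i * x $ j / s\<^sup>2" for i j
    by (simp add: alpha_matrix_def s_def)
  have r: "(x $ 2)\<^sup>2 = 1 - s - (x $ 1)\<^sup>2" by (simp add: s_def norm2_real2)
  have b: "beta_covector x $ i = x $ i / s" for i
    by (simp add: beta_covector_def s_def)
  define B :: "real^2^2"
    where "B = (\<chi> i j. s * ((if i = j then 1 else 0) - x $ i * x $ j))"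
  have inv: "matrix_inv (alpha_matrix x) = B"
  proof -
    have e: "(B ** alpha_matrix x) $ i $ j = mat 1 $ i $ j" for i j
    proof -
      have "(B ** alpha_matrix x) $ i $ j
        = (if i = j then 1 else 0) + x $ i * x $ j * (1 - s - ((x $ 1)\<^sup>2 + (x $ 2)\<^sup>2)) / s"
        using s exhaust_2[of i] exhaust_2[of j]
        by (auto simp: B_def A matrix_matrix_mult_def sum_2 field_simps power2_eq_square)
      then show ?thesis by (simp add: r mat_def)
    qed
    then have "B ** alpha_matrix x = mat 1" by (simp add: vec_eq_iff)
    moreover from this have "alpha_matrix x ** B = mat 1"
      using matrix_left_right_inverse by blast
    ultimately have "matrix_inv (alpha_matrix x) ** alpha_matrix x = mat 1"
      and r: "alpha_matrix x ** B = mat 1"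
      using someI[of "\<lambda>C. alpha_matrix x ** C = mat 1 \<and> C ** alpha_matrix x = mat 1" B]
      by (simp_all add: matrix_inv_def)
    then have "matrix_inv (alpha_matrix x) ** (alpha_matrix x ** B) = B"
      unfolding matrix_mul_assoc by simp
    then show ?thesis by (simp add: r)
  qed
  have "(\<Sum>i\<in>UNIV. \<Sum>j\<in>UNIV.
      matrix_inv (alpha_matrix x) $ i $ j * beta_covector x $ i * beta_covector x $ j)
    = ((x $ 1)\<^sup>2 + (x $ 2)\<^sup>2) * (1 - ((x $ 1)\<^sup>2 + (x $ 2)\<^sup>2)) / s"
    using s by (simp add: inv B_def b sum_2 field_simps power2_eq_square)
  also have "\<dots> = (norm x)\<^sup>2" using s by (simp add: norm2_real2[symmetric] s_def)
  finally show ?thesis by (simp add: beta_norm_def)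
qed

lemma sigma_BH_eq: "x \<in> disc \<Longrightarrow> sigma_BH x = 1"
  using disc_gap_pos[of x]
  by (simp add: sigma_BH_def beta_norm_eq sigma_alpha_eq powr_add[symmetric])

lemma sigma_max_min_eq:
  assumes "x \<in> disc"
  shows "sigma_max x = ((1 + norm x) / (1 - norm x)) powr (3 / 2)"
    and "sigma_min x = ((1 - norm x) / (1 + norm x)) powr (3 / 2)"
proof -
  have p: "0 < 1 + norm x" "0 < 1 - norm x"
    using assms by (simp_all add: add_pos_nonneg)
  have f: "1 - (norm x)\<^sup>2 = (1 + norm x) * (1 - norm x)"
    by (simp add: power2_eq_square algebra_simps)
  have c: "a ^ 3 * (a * b) powr (- 3 / 2) = (a / b) powr (3 / 2)" if "a > 0" "b > 0" for a b :: real
  proof -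
    have "a ^ 3 = a powr (3 + 0)" using that by simp
    also have "\<dots> = a powr (3 / 2) * a powr (3 / 2)"
      unfolding powr_add[symmetric] by simp
    finally show ?thesis using that by (simp add: powr_mult powr_divide powr_minus field_simps)
  qed
  show "sigma_max x = ((1 + norm x) / (1 - norm x)) powr (3 / 2)"
    using c[OF p] by (simp add: sigma_max_def beta_norm_eq[OF assms] sigma_alpha_eq[OF assms] f)
  show "sigma_min x = ((1 - norm x) / (1 + norm x)) powr (3 / 2)"
    using c[OF p(2,1)]
    by (simp add: sigma_min_def beta_norm_eq[OF assms] sigma_alpha_eq[OF assms] f mult.commute)
qed

end

(*
  The indicatrix of the Funk metric at x is the unit circle translated by -x, so the dual metric is
  |xi| - <xi,x>, and by Euler's identity the gradient of a function with differential xi is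
  (|xi| - <xi,x>) (xi / |xi| - x). By homogeneity d(x,q) = ln (F(q,q-x) / F(x,q-x)), and letting q tend to y along
  the geodesic gives the Busemann function ln ((1 - <p,y>) / (1 - <x,y>)), whose gradient is
  therefore y - x. For every density sigma its Laplacian is the sigma-divergence of
  this field, namely -2 plus the derivative of ln sigma in the direction y - x.
*)

theory Submission
  imports Defs
begin

section \<open>Indicatrix and positivity of the Funk metric\<close>

lemma inner_less_one:
  fixes x y :: "'a::real_inner"
  assumes "norm x < 1" "norm y = 1"
  shows "x \<bullet> y < 1"
  using norm_cauchy_schwarz[of x y] assms by simp

text \<open>With s = 1 - |x|^2 and c = <x,v>, the equation F = 1 reads sqrt(s |v|^2 + c^2) = s - c.
  Squaring and cancelling s leaves |v|^2 + 2c = s, which is |x + v|^2 = 1.\<close>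

lemma funk_metric_eq_1_iff:
  assumes "x \<in> disc"
  shows "funk_metric x v = 1 \<longleftrightarrow> norm (x + v) = 1"
proof -
  define s where "s = 1 - (norm x)\<^sup>2"
  define c where "c = x \<bullet> v"
  have s: "s > 0" using disc_gap_pos[OF assms] by (simp add: s_def)
  have "funk_metric x v = 1 \<longleftrightarrow> sqrt (s * (norm v)\<^sup>2 + c\<^sup>2) = s - c"
    using s by (auto simp: funk_metric_def funk_alpha_def funk_beta_def s_def[symmetric]
        c_def[symmetric] field_simps)
  also have "\<dots> \<longleftrightarrow> (norm v)\<^sup>2 + 2 * c = s"
  proof
    assume "sqrt (s * (norm v)\<^sup>2 + c\<^sup>2) = s - c"
    then have "(sqrt (s * (norm v)\<^sup>2 + c\<^sup>2))\<^sup>2 = (s - c)\<^sup>2" by simp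
    then have "s * (norm v)\<^sup>2 + c\<^sup>2 = (s - c)\<^sup>2" using s by simp
    then have "s * ((norm v)\<^sup>2 + 2 * c) = s * s" by (simp add: power2_eq_square algebra_simps)
    then show "(norm v)\<^sup>2 + 2 * c = s" using s by simp
  next
    assume v: "(norm v)\<^sup>2 + 2 * c = s"
    \<comment> \<open>Squaring is reversible only where s - c is nonnegative, which this identity
      shows.\<close>
    then have "2 * (s - c) = s + (norm v)\<^sup>2" by simp
    then have "2 * (s - c) \<ge> 0" using s by (simp only:) simp
    then have "s - c \<ge> 0" by simp
    moreover have "s * (norm v)\<^sup>2 + c\<^sup>2 = (s - c)\<^sup>2"
      unfolding v[symmetric] by (simp add: power2_eq_square algebra_simps)
    ultimately show "sqrt (s * (norm v)\<^sup>2 + c\<^sup>2) = s - c" by simp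
  qed
  also have "\<dots> \<longleftrightarrow> (norm (x + v))\<^sup>2 = 1"
    by (auto simp: s_def c_def power2_norm_eq_inner inner_add_left inner_add_right inner_commute)
  also have "\<dots> \<longleftrightarrow> norm (x + v) = 1"
    by (metis norm_ge_zero one_power2 power2_eq_iff_nonneg zero_le_one)
  finally show ?thesis .
qed

text \<open>The term s |v|^2 under the root makes \<open>funk_alpha\<close> strictly larger than the
  absolute value of \<open>funk_beta\<close>.\<close>

lemma funk_metric_pos:
  assumes "x \<in> disc" "v \<noteq> 0"
  shows "funk_metric x v > 0"
proof -
  define s where "s = 1 - (norm x)\<^sup>2"
  have s: "s > 0" using disc_gap_pos[OF assms(1)] by (simp add: s_def)
  have "\<bar>x \<bullet> v\<bar> = sqrt ((x \<bullet> v)\<^sup>2)" by simp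
  also have "\<dots> < sqrt (s * (norm v)\<^sup>2 + (x \<bullet> v)\<^sup>2)"
    using s assms(2) by (simp only: real_sqrt_less_iff) simp
  finally have "0 < sqrt (s * (norm v)\<^sup>2 + (x \<bullet> v)\<^sup>2) + x \<bullet> v" by linarith
  then have "0 < (sqrt (s * (norm v)\<^sup>2 + (x \<bullet> v)\<^sup>2) + x \<bullet> v) / s" using s by simp
  then show ?thesis
    by (simp add: funk_metric_def funk_alpha_def funk_beta_def s_def[symmetric] add_divide_distrib)
qed

section \<open>Homogeneity, exit points of rays, and the Funk distance\<close>

lemma funk_metric_scaleR:
  assumes "r \<ge> 0"
  shows "funk_metric x (r *\<^sub>R v) = r * funk_metric x v"
proof -
  have "sqrt ((1 - (norm x)\<^sup>2) * (norm (r *\<^sub>R v))\<^sup>2 + (x \<bullet> (r *\<^sub>R v))\<^sup>2)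
      = sqrt (r\<^sup>2 * ((1 - (norm x)\<^sup>2) * (norm v)\<^sup>2 + (x \<bullet> v)\<^sup>2))"
    by (simp add: power_mult_distrib algebra_simps)
  also have "\<dots> = r * sqrt ((1 - (norm x)\<^sup>2) * (norm v)\<^sup>2 + (x \<bullet> v)\<^sup>2)"
    unfolding real_sqrt_mult using assms by simp
  finally show ?thesis
    by (simp add: funk_metric_def funk_alpha_def funk_beta_def distrib_left)
qed

text \<open>By homogeneity F(x, s u) = s F(x, u), and a vector based at x has Funk length 1 exactly
  when its tip lies on the unit circle.\<close>

lemma norm_ray_eq_1_iff:
  assumes "x \<in> disc" "u \<noteq> 0" "s \<ge> 0"
  shows "norm (x + s *\<^sub>R u) = 1 \<longleftrightarrow> s = 1 / funk_metric x u"
  using assms funk_metric_pos[of x u] funk_metric_eq_1_iff[of x "s *\<^sub>R u"]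
  by (auto simp: funk_metric_scaleR field_simps)

text \<open>The equivalence for the ray parameter supplies both existence and uniqueness, as the
  description operator demands.\<close>

lemma ray_exit_eq:
  assumes "x \<in> disc" "q \<noteq> x"
  shows "ray_exit x q = x + (1 / funk_metric x (q - x)) *\<^sub>R (q - x)"
  unfolding ray_exit_def
proof (rule the_equality)
  have pos: "1 / funk_metric x (q - x) \<ge> 0"
    using funk_metric_pos[of x "q - x"] assms by simp
  let ?a = "x + (1 / funk_metric x (q - x)) *\<^sub>R (q - x)"
  show "?a \<in> sphere 0 1 \<and> (\<exists>s\<ge>0. ?a = x + s *\<^sub>R (q - x))"
    using norm_ray_eq_1_iff[OF assms(1) _ pos, of "q - x"] assms(2) pos by auto
next
  fix a assume "a \<in> sphere 0 1 \<and> (\<exists>s\<ge>0. a = x + s *\<^sub>R (q - x))"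
  then show "a = x + (1 / funk_metric x (q - x)) *\<^sub>R (q - x)"
    using norm_ray_eq_1_iff[OF assms(1), of "q - x"] assms(2) by auto
qed

text \<open>The ray leaves the disc at the same point whether it is followed from x or from q in
  direction u = q - x. The two exit parameters therefore satisfy s = 1 + r, and the ratio of
  Euclidean distances is s / r = F(q,u) / F(x,u).\<close>

lemma funk_dist_eq:
  assumes "x \<in> disc" "q \<in> disc" "q \<noteq> x"
  shows "funk_dist x q = ln (funk_metric q (q - x) / funk_metric x (q - x))"
proof -
  define u where "u = q - x"
  define s where "s = 1 / funk_metric x u"
  define r where "r = 1 / funk_metric q u"
  have u: "u \<noteq> 0" using assms by (simp add: u_def)
  have pos: "funk_metric x u > 0" "funk_metric q u > 0"
    using funk_metric_pos u assms by auto
  then have r: "r > 0" by (simp add: r_def)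
  have "norm (q + r *\<^sub>R u) = 1"
    using norm_ray_eq_1_iff[OF assms(2) u, of r] r by (simp add: r_def)
  moreover have "q + r *\<^sub>R u = x + (1 + r) *\<^sub>R u" by (simp add: u_def algebra_simps)
  ultimately have s: "s = 1 + r"
    using norm_ray_eq_1_iff[OF assms(1) u, of "1 + r"] r by (simp add: s_def)
  have a: "ray_exit x q = x + s *\<^sub>R u"
    using ray_exit_eq[OF assms(1,3)] by (simp add: s_def u_def)
  have "norm (x - ray_exit x q) = s * norm u"
    using s r by (simp add: a)
  moreover have "q - ray_exit x q = - (r *\<^sub>R u)"
    unfolding a s by (simp add: u_def algebra_simps)
  then have "norm (q - ray_exit x q) = r * norm u" using r by simp
  ultimately have "funk_dist x q = ln (s / r)"
    using assms(3) u by (simp add: funk_dist_def)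
  then show ?thesis using pos by (simp add: s_def r_def u_def)
qed

section \<open>The forward geodesic and its Busemann function\<close>

lemma funk_geodesic_in_disc:
  assumes "p \<in> disc" "norm y = 1" "t \<ge> 0"
  shows "funk_geodesic p y t \<in> disc"
proof -
  have "norm (funk_geodesic p y t) \<le> exp (- t) * norm p + (1 - exp (- t)) * norm y"
    unfolding funk_geodesic_def using assms(3)
    by (intro order_trans[OF norm_triangle_ineq]) simp
  also have "\<dots> < exp (- t) * 1 + (1 - exp (- t))"
    using assms by simp
  finally show ?thesis by simp
qed

lemma funk_geodesic_tendsto: "(funk_geodesic p y \<longlongrightarrow> y) at_top"
proof -
  have "((\<lambda>t::real. exp (- t)) \<longlongrightarrow> 0) at_top"
    by (intro filterlim_compose[OF exp_at_bot] filterlim_uminus_at_bot_at_top)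
  then have "((\<lambda>t. exp (- t) *\<^sub>R p + (1 - exp (- t)) *\<^sub>R y) \<longlongrightarrow> 0 *\<^sub>R p + (1 - 0) *\<^sub>R y) at_top"
    by (intro tendsto_intros)
  then show ?thesis by (simp add: funk_geodesic_def[abs_def])
qed

text \<open>Here t - d(x, q t) = ln F(x, q t - x) - ln (exp(-t) F(q t, q t - x)). The first term
  tends to ln F(x, y - x) = 0. In the second, the factor exp(-t) compensates the blow-up of the
  metric at the boundary.\<close>

lemma busemann_funk_geodesic:
  assumes p: "p \<in> disc" and y: "norm y = 1" and x: "x \<in> disc"
  shows "busemann (funk_geodesic p y) x = ln ((1 - p \<bullet> y) / (1 - x \<bullet> y))"
proof -
  define q where "q = funk_geodesic p y"
  \<comment> \<open>This is 1 - |q t|^2 with the factor exp(-t) taken out: expanding q t = y +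
    exp(-t) (p - y), the constant term cancels because |y| = 1.\<close>
  define k where "k t = 2 * (1 - p \<bullet> y) - exp (- t) * (norm (p - y))\<^sup>2" for t :: real
  have py: "p \<bullet> y < 1" and xy: "x \<bullet> y < 1"
    using inner_less_one p x y by auto
  have xney: "x \<noteq> y" using x y by auto
  have yy: "y \<bullet> y = 1" using y by (simp add: power2_norm_eq_inner[symmetric])
  have e: "((\<lambda>t::real. exp (- t)) \<longlongrightarrow> 0) at_top"
    by (intro filterlim_compose[OF exp_at_bot] filterlim_uminus_at_bot_at_top)
  have q: "(q \<longlongrightarrow> y) at_top" unfolding q_def by (rule funk_geodesic_tendsto)
  have u: "((\<lambda>t. q t - x) \<longlongrightarrow> y - x) at_top" by (intro tendsto_intros q)
  have k: "(k \<longlongrightarrow> 2 * (1 - p \<bullet> y)) at_top"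
    unfolding k_def by (rule tendsto_eq_intros e refl | simp)+
  have gap: "1 - (norm (q t))\<^sup>2 = exp (- t) * k t" for t
  proof -
    define w where "w = p - y"
    have "q t = y + exp (- t) *\<^sub>R w"
      by (simp add: w_def q_def funk_geodesic_def algebra_simps)
    then have "(norm (q t))\<^sup>2 = 1 + 2 * exp (- t) * (y \<bullet> w) + (exp (- t))\<^sup>2 * (norm w)\<^sup>2"
      unfolding power2_norm_eq_inner
      by (simp add: inner_simps yy inner_commute power2_eq_square)
    moreover have "y \<bullet> w = p \<bullet> y - 1" by (simp add: w_def inner_diff_right yy inner_commute)
    ultimately show ?thesis
      by (simp add: k_def w_def[symmetric] power2_eq_square algebra_simps)
  qed
  have sq: "norm (q t) < 1" if "t \<ge> 0" for t
    using funk_geodesic_in_disc[OF p y that] by (simp add: q_def)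
  have qne: "eventually (\<lambda>t. q t \<noteq> x) at_top"
    using tendsto_imp_eventually_ne[OF q] xney by metis
  \<comment> \<open>\<open>G t\<close> stands for exp(-t) F(q t, q t - x): the vanishing denominator
    1 - |q t|^2 is replaced by \<open>k t\<close>, whose limit is positive.\<close>
  define G where "G t = (sqrt ((1 - (norm (q t))\<^sup>2) * (norm (q t - x))\<^sup>2 + (q t \<bullet> (q t - x))\<^sup>2)
      + q t \<bullet> (q t - x)) / k t" for t
  have "(G \<longlongrightarrow> (sqrt ((1 - (norm y)\<^sup>2) * (norm (y - x))\<^sup>2 + (y \<bullet> (y - x))\<^sup>2)
      + y \<bullet> (y - x)) / (2 * (1 - p \<bullet> y))) at_top"
    unfolding G_def using py by (intro tendsto_intros q u k) simp
  \<comment> \<open>At the boundary point the root collapses to <y, y - x> = 1 - <x,y>, so the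
    numerator is twice this number and the factor 2 cancels.\<close>
  also have "(sqrt ((1 - (norm y)\<^sup>2) * (norm (y - x))\<^sup>2 + (y \<bullet> (y - x))\<^sup>2)
      + y \<bullet> (y - x)) / (2 * (1 - p \<bullet> y)) = (1 - x \<bullet> y) / (1 - p \<bullet> y)"
    using xy py by (simp add: y yy inner_diff_right inner_commute field_simps)
  finally have G: "(G \<longlongrightarrow> (1 - x \<bullet> y) / (1 - p \<bullet> y)) at_top" .
  have "isCont (funk_metric x) (y - x)"
    unfolding funk_metric_def funk_alpha_def funk_beta_def
    using disc_gap_pos[OF x] by (intro continuous_intros) auto
  then have "((\<lambda>t. funk_metric x (q t - x)) \<longlongrightarrow> funk_metric x (y - x)) at_top"
    by (rule isCont_tendsto_compose[OF _ u])
  moreover have "funk_metric x (y - x) = 1" using funk_metric_eq_1_iff[OF x] y by simp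
  ultimately have F: "((\<lambda>t. funk_metric x (q t - x)) \<longlongrightarrow> 1) at_top" by simp
  have "((\<lambda>t. ln (funk_metric x (q t - x)) - ln (G t))
      \<longlongrightarrow> ln 1 - ln ((1 - x \<bullet> y) / (1 - p \<bullet> y))) at_top"
    using xy py by (intro tendsto_intros F G) auto
  also have "ln 1 - ln ((1 - x \<bullet> y) / (1 - p \<bullet> y)) = ln ((1 - p \<bullet> y) / (1 - x \<bullet> y))"
    using xy py by (simp add: ln_div)
  finally have lim: "((\<lambda>t. ln (funk_metric x (q t - x)) - ln (G t))
      \<longlongrightarrow> ln ((1 - p \<bullet> y) / (1 - x \<bullet> y))) at_top" .
  have "eventually (\<lambda>t. ln (funk_metric x (q t - x)) - ln (G t) = t - funk_dist x (q t)) at_top"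
    using qne eventually_ge_at_top[of 0]
  proof eventually_elim
    case (elim t)
    then have qd: "q t \<in> disc" using sq by simp
    have pos: "funk_metric x (q t - x) > 0" "funk_metric (q t) (q t - x) > 0"
      using funk_metric_pos x qd elim by auto
    have "funk_metric (q t) (q t - x) = exp t * G t"
    proof -
      have "exp t * (a / k t) = a / (exp (- t) * k t)" for a
        by (simp add: exp_minus field_simps)
      then show ?thesis
        unfolding G_def funk_metric_def funk_alpha_def funk_beta_def
          add_divide_distrib[symmetric] by (simp only: gap[symmetric])
    qed
    \<comment> \<open>Positivity of \<open>G t\<close> is inherited from the metric, without
      examining the sign of \<open>k t\<close>.\<close>
    moreover from this pos have "G t > 0" by (simp add: zero_less_mult_iff)
    ultimately show ?case
      using pos by (simp add: funk_dist_eq[OF x qd] elim ln_div ln_mult)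
  qed
  then have "((\<lambda>t. t - funk_dist x (q t)) \<longlongrightarrow> ln ((1 - p \<bullet> y) / (1 - x \<bullet> y))) at_top"
    using lim by (rule Lim_transform_eventually[rotated])
  then show ?thesis
    unfolding busemann_def q_def by (intro tendsto_Lim) simp_all
qed

section \<open>The dual metric and its fundamental tensor\<close>

lemma dual_metric_funk:
  assumes "x \<in> disc"
  shows "dual_metric funk_metric x \<xi> = norm \<xi> - \<xi> \<bullet> x"
  unfolding dual_metric_def
proof (rule cSup_eq_maximum)
  \<comment> \<open>The maximizer is w - x, where w is the unit vector giving equality in
    Cauchy-Schwarz; for \<xi> = 0 any unit vector serves.\<close>
  obtain w :: "real^2" where w: "norm w = 1" "\<xi> \<bullet> w = norm \<xi>"
  proof (cases "\<xi> = 0")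
    case True
    then show ?thesis using that[of "axis 1 1"] by (simp add: norm_axis_1)
  next
    case False
    then show ?thesis using that[of "\<xi> /\<^sub>R norm \<xi>"]
      by (simp add: power2_norm_eq_inner[symmetric] power2_eq_square)
  qed
  then have "funk_metric x (w - x) = 1" using funk_metric_eq_1_iff[OF assms] by simp
  then show "norm \<xi> - \<xi> \<bullet> x \<in> (\<bullet>) \<xi> ` {v. funk_metric x v = 1}"
    using w(2) by (intro image_eqI[of _ _ "w - x"]) (auto simp: inner_diff_right)
next
  fix a assume "a \<in> (\<bullet>) \<xi> ` {v. funk_metric x v = 1}"
  then obtain v where v: "a = \<xi> \<bullet> v" "norm (x + v) = 1"
    using funk_metric_eq_1_iff[OF assms] by auto
  have "\<xi> \<bullet> (x + v) \<le> norm \<xi>" using norm_cauchy_schwarz[of \<xi> "x + v"] v(2) by simp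
  then show "a \<le> norm \<xi> - \<xi> \<bullet> x" by (simp add: v(1) inner_add_right)
qed

text \<open>The chain rule along the coordinate line reduces partial derivatives to Frechet
  derivatives, in which all later calculus is done.\<close>

lemma partial_deriv_eq:
  assumes "(f has_derivative f') (at x)"
  shows "partial_deriv i f x = f' (axis i 1)"
proof -
  have "((\<lambda>h. x + h *\<^sub>R axis i 1) has_derivative (\<lambda>h. h *\<^sub>R axis i 1)) (at 0)"
    by (auto intro!: derivative_eq_intros)
  moreover have "(f has_derivative f') (at (x + 0 *\<^sub>R axis i 1))" using assms by simp
  ultimately have "((\<lambda>h. f (x + h *\<^sub>R axis i 1)) has_derivative (\<lambda>h. f' (h *\<^sub>R axis i 1))) (at 0)"
    by (rule has_derivative_compose)
  moreover have "(\<lambda>h. f' (h *\<^sub>R axis i 1)) = (*) (f' (axis i 1))"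
    using has_derivative_linear[OF assms] by (auto simp: linear_cmul)
  ultimately show ?thesis
    unfolding partial_deriv_def by (intro DERIV_imp_deriv) (simp add: has_field_derivative_def)
qed

text \<open>Partial derivatives are local. This allows closed formulas that are established only on
  the disc, or only off the origin.\<close>

lemma partial_deriv_eq_open:
  assumes "(f has_derivative f') (at x)" "open S" "x \<in> S" "\<And>z. z \<in> S \<Longrightarrow> g z = f z"
  shows "partial_deriv i g x = f' (axis i 1)"
  using assms by (intro partial_deriv_eq has_derivative_transform_within_open[OF assms(1-3)]) auto

lemma has_derivative_vec_nth:
  "((\<lambda>x. x $ i) has_derivative (\<lambda>h. h $ i)) (at (x :: 'a::real_normed_vector^'n))"
  by (rule bounded_linear_imp_has_derivative[OF bounded_linear_vec_nth])

lemma has_derivative_norm_inner: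
  assumes "(x::'a::real_inner) \<noteq> 0"
  shows "(norm has_derivative (\<lambda>h. (x \<bullet> h) / norm x)) (at x)"
  using has_derivative_norm[OF assms] by (simp add: sgn_div_norm inner_commute divide_inverse
      mult.commute)

text \<open>For N = |\<xi>| - <\<xi>,x>, half the Hessian of N^2 is the product of the first
  derivatives of N plus N times the Hessian of N. The linear term drops out of the latter, which
  leaves the Hessian of the Euclidean norm.\<close>

lemma dual_tensor_funk:
  assumes x: "x \<in> disc" and \<xi>: "\<xi> \<noteq> 0"
  shows "dual_tensor funk_metric x \<xi> i j =
    (\<xi> $ i / norm \<xi> - x $ i) * (\<xi> $ j / norm \<xi> - x $ j)
    + (norm \<xi> - \<xi> \<bullet> x) * ((if i = j then 1 else 0) / norm \<xi> - \<xi> $ i * \<xi> $ j / norm \<xi> ^ 3)"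
proof -
  have d1: "partial_deriv j (\<lambda>\<eta>. (dual_metric funk_metric x \<eta>)\<^sup>2) \<eta>
      = 2 * (norm \<eta> - \<eta> \<bullet> x) * (\<eta> $ j / norm \<eta> - x $ j)" if "\<eta> \<noteq> 0" for \<eta>
  proof -
    have "((\<lambda>\<eta>. (norm \<eta> - \<eta> \<bullet> x)\<^sup>2) has_derivative
        (\<lambda>h. 2 * (norm \<eta> - \<eta> \<bullet> x) * ((\<eta> \<bullet> h) / norm \<eta> - h \<bullet> x))) (at \<eta>)"
      by (rule derivative_eq_intros has_derivative_norm_inner[OF that] refl | simp)+
        (simp add: fun_eq_iff that field_simps)
    from partial_deriv_eq[OF this, of j] show ?thesis
      by (simp add: dual_metric_funk[OF x] inner_axis inner_axis')
  qed
  define D where "D = (\<lambda>h. 2 * ((\<xi> \<bullet> h) / norm \<xi> - h \<bullet> x) * (\<xi> $ j / norm \<xi> - x $ j)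
        + 2 * (norm \<xi> - \<xi> \<bullet> x) * (h $ j / norm \<xi> - \<xi> $ j * (\<xi> \<bullet> h) / norm \<xi> ^ 3))"
  have D: "((\<lambda>\<eta>. 2 * (norm \<eta> - \<eta> \<bullet> x) * (\<eta> $ j / norm \<eta> - x $ j)) has_derivative D) (at \<xi>)"
    unfolding D_def
    by (rule derivative_eq_intros has_derivative_norm_inner[OF \<xi>] has_derivative_vec_nth refl \<xi>
       | simp add: \<xi>)+ (simp add: fun_eq_iff \<xi> field_simps power3_eq_cube power2_eq_square)
  have "partial_deriv i (partial_deriv j (\<lambda>\<eta>. (dual_metric funk_metric x \<eta>)\<^sup>2)) \<xi> = D (axis i 1)"
    using \<xi> d1 by (intro partial_deriv_eq_open[OF D open_delete[OF open_UNIV, of 0]]) auto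
  also have "\<dots> = 2 * ((\<xi> $ i / norm \<xi> - x $ i) * (\<xi> $ j / norm \<xi> - x $ j)
    + (norm \<xi> - \<xi> \<bullet> x) * ((if i = j then 1 else 0) / norm \<xi> - \<xi> $ i * \<xi> $ j / norm \<xi> ^ 3))"
  proof -
    have "axis i (1::real) $ j = (if i = j then 1 else 0)" by (simp add: axis_def)
    then show ?thesis
      unfolding D_def inner_axis inner_axis' by (simp only: distrib_left mult_ac) simp
  qed
  finally show ?thesis by (simp add: dual_tensor_def)
qed

text \<open>This is Euler's identity for the 2-homogeneous function \<open>(F\<^sup>*)\<^sup>2 / 2\<close>.\<close>

lemma dual_tensor_funk_contract:
  assumes x: "x \<in> disc" and \<xi>: "\<xi> \<noteq> 0"
  shows "(\<Sum>j\<in>UNIV. dual_tensor funk_metric x \<xi> i j * \<xi> $ j)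
    = (norm \<xi> - \<xi> \<bullet> x) * (\<xi> $ i / norm \<xi> - x $ i)"
proof -
  define n where "n = norm \<xi>"
  have n: "n > 0" using \<xi> by (simp add: n_def)
  have sq: "(\<Sum>j\<in>UNIV. \<xi> $ j * \<xi> $ j) = n\<^sup>2"
    by (simp add: n_def power2_norm_eq_inner inner_vec_def)
  have ix: "(\<Sum>j\<in>UNIV. x $ j * \<xi> $ j) = \<xi> \<bullet> x"
    by (simp add: inner_vec_def mult.commute)
  have "(\<Sum>j\<in>UNIV. dual_tensor funk_metric x \<xi> i j * \<xi> $ j)
    = (\<xi> $ i / n - x $ i) * ((\<Sum>j\<in>UNIV. \<xi> $ j * \<xi> $ j) / n - (\<Sum>j\<in>UNIV. x $ j * \<xi> $ j))
    + (n - \<xi> \<bullet> x) * (\<xi> $ i / n - \<xi> $ i * (\<Sum>j\<in>UNIV. \<xi> $ j * \<xi> $ j) / n ^ 3)"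
    using exhaust_2[of i] n
    by (auto simp: dual_tensor_funk[OF x \<xi>] n_def[symmetric] sum_2 field_simps)
  also have "\<dots> = (n - \<xi> \<bullet> x) * (\<xi> $ i / n - x $ i)"
    unfolding sq ix using n by (simp add: field_simps power2_eq_square power3_eq_cube)
  finally show ?thesis by (simp add: n_def)
qed

section \<open>Differential, gradient and Laplacian of the Busemann function\<close>

lemma partial_deriv_busemann:
  assumes p: "p \<in> disc" and y: "norm y = 1" and z: "z \<in> disc"
  shows "partial_deriv j (busemann (funk_geodesic p y)) z = y $ j / (1 - z \<bullet> y)"
proof -
  have py: "p \<bullet> y < 1" and zy: "z \<bullet> y < 1"
    using inner_less_one p z y by auto
  have b: "busemann (funk_geodesic p y) x = ln (1 - p \<bullet> y) - ln (1 - x \<bullet> y)" if "x \<in> disc" for x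
    using busemann_funk_geodesic[OF p y that] py inner_less_one[of x y] that y
    by (simp add: ln_div)
  have "((\<lambda>z. ln (1 - p \<bullet> y) - ln (1 - z \<bullet> y)) has_derivative (\<lambda>h. (h \<bullet> y) / (1 - z \<bullet> y))) (at z)"
    using zy by (auto intro!: derivative_eq_intros simp: fun_eq_iff field_simps)
  from partial_deriv_eq_open[OF this open_ball z b]
  show ?thesis by (simp add: inner_axis')
qed

text \<open>The differential is y / c with c = 1 - <z,y> > 0, so its dual norm is (1 - <y,z>) / c =
  1 and its Euclidean direction is y. The contracted tensor then reduces to y - z.\<close>

lemma funk_gradient_busemann:
  assumes p: "p \<in> disc" and y: "norm y = 1" and z: "z \<in> disc"
  defines "b \<equiv> busemann (funk_geodesic p y)"
  shows "(\<Sum>j\<in>UNIV. dual_tensor funk_metric z (differential b z) i j * partial_deriv j b z)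
    = y $ i - z $ i"
proof -
  define c where "c = 1 - z \<bullet> y"
  have c: "c > 0" using inner_less_one[of z y] z y by (simp add: c_def)
  define \<xi> where "\<xi> = differential b z"
  have \<xi>: "\<xi> = (1 / c) *\<^sub>R y"
    by (simp add: \<xi>_def differential_def vec_eq_iff b_def partial_deriv_busemann[OF p y z] c_def)
  have "\<xi> \<noteq> 0" using c y by (auto simp: \<xi>)
  moreover have "partial_deriv j b z = \<xi> $ j" for j by (simp add: \<xi>_def differential_def)
  moreover have "norm \<xi> - \<xi> \<bullet> z = 1" "\<xi> $ i / norm \<xi> = y $ i"
    using c y by (simp_all add: \<xi> diff_divide_distrib[symmetric] inner_commute)
      (simp add: c_def inner_commute)
  ultimately show ?thesis
    using dual_tensor_funk_contract[OF z, of \<xi> i] by (simp add: \<xi>_def)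
qed

text \<open>The product rule for \<tau>(z) (y - z) gives the derivative of \<tau> along y - x, minus
  \<tau> once for each of the two coordinates. The function \<tau> is a differentiable closed form
  of the density on the disc.\<close>

lemma shen_laplacian_busemann:
  assumes p: "p \<in> disc" and y: "norm y = 1" and x: "x \<in> disc"
    and d: "(\<tau> has_derivative \<tau>') (at x)"
    and eq: "\<And>z. z \<in> disc \<Longrightarrow> \<sigma> z = \<tau> z" and nz: "\<tau> x \<noteq> 0"
  shows "shen_laplacian funk_metric \<sigma> (busemann (funk_geodesic p y)) x
    = - 2 + \<tau>' (y - x) / \<tau> x"
proof -
  have "partial_deriv i (\<lambda>z. \<sigma> z * (\<Sum>j\<in>UNIV.
      dual_tensor funk_metric z (differential (busemann (funk_geodesic p y)) z) i j *
      partial_deriv j (busemann (funk_geodesic p y)) z)) x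
    = \<tau>' (axis i 1) * (y $ i - x $ i) - \<tau> x" for i
  proof -
    have "((\<lambda>z. \<tau> z * (y $ i - z $ i)) has_derivative
        (\<lambda>h. \<tau>' h * (y $ i - x $ i) - \<tau> x * h $ i)) (at x)"
      by (rule derivative_eq_intros d has_derivative_vec_nth refl | simp)+
    from partial_deriv_eq_open[OF this open_ball x]
    show ?thesis using x by (simp add: funk_gradient_busemann[OF p y] eq)
  qed
  then have "shen_laplacian funk_metric \<sigma> (busemann (funk_geodesic p y)) x
      = (\<Sum>i\<in>UNIV. \<tau>' (axis i 1) * (y $ i - x $ i) - \<tau> x) / \<tau> x"
    using x by (simp add: shen_laplacian_def eq)
  also have "(\<Sum>i\<in>UNIV. \<tau>' (axis i 1) * (y $ i - x $ i) - \<tau> x) = \<tau>' (y - x) - 2 * \<tau> x"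
  proof -
    have lin: "linear \<tau>'" using d by (rule has_derivative_linear)
    \<comment> \<open>Linearity assembles the coordinate terms into one directional
      derivative.\<close>
    have "\<tau>' (y - x) = \<tau>' (\<Sum>i\<in>UNIV. ((y - x) $ i) *\<^sub>R axis i 1)"
      using basis_expansion[of "y - x"] by (simp add: scalar_mult_eq_scaleR)
    also have "\<dots> = (\<Sum>i\<in>UNIV. \<tau>' (axis i 1) * (y $ i - x $ i))"
      by (simp add: linear_sum[OF lin] linear_cmul[OF lin] mult.commute)
    finally show ?thesis by (simp add: sum_subtractf)
  qed
  finally show ?thesis using nz by (simp add: diff_divide_distrib)
qed

text \<open>The power itself is kept as a factor, so that division by the density leaves the
  logarithmic derivative.\<close>

lemma has_derivative_powr_const:
  fixes f :: "_ \<Rightarrow> real"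
  assumes "(f has_derivative f') (at x)" "f x > 0"
  shows "((\<lambda>z. f z powr a) has_derivative (\<lambda>h. a * f' h / f x * f x powr a)) (at x)"
  using has_derivative_powr[OF assms(1) has_derivative_const[of a] assms(2) UNIV_I]
  by (simp add: mult_ac)

section \<open>Comparison of the four volume densities\<close>

theorem corollary7p2:
  fixes p y :: "real^2" and \<gamma> :: "real \<Rightarrow> real^2" and b :: "real^2 \<Rightarrow> real"
  assumes "p \<in> disc" and "y \<in> sphere 0 1"
    and "\<gamma> = funk_geodesic p y" and "b = busemann \<gamma>"
  shows "(\<forall>x\<in>disc.
            shen_laplacian funk_metric sigma_HT b x =
            shen_laplacian funk_metric sigma_BH b x
              + 3 * (x \<bullet> y - (norm x)\<^sup>2) / (1 - (norm x)\<^sup>2)) \<and>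
         (\<forall>x\<in>disc - {0}.
            shen_laplacian funk_metric sigma_max b x =
            shen_laplacian funk_metric sigma_BH b x
              + 3 * (x \<bullet> y - (norm x)\<^sup>2) / (norm x * (1 - (norm x)\<^sup>2))) \<and>
         (\<forall>x\<in>disc - {0}.
            shen_laplacian funk_metric sigma_min b x =
            shen_laplacian funk_metric sigma_BH b x
              - 3 * (x \<bullet> y - (norm x)\<^sup>2) / (norm x * (1 - (norm x)\<^sup>2)))"
proof -
  have y: "norm y = 1" using assms(2) by simp
  have b: "b = busemann (funk_geodesic p y)" using assms by simp
  note lap = shen_laplacian_busemann[OF assms(1) y, folded b]
  have xyx: "x \<bullet> (y - x) = x \<bullet> y - (norm x)\<^sup>2" for x
    by (simp add: inner_diff_right power2_norm_eq_inner)
  \<comment> \<open>Constant density leaves only the Euclidean divergence of y - z, so each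
    remaining claim is about the logarithmic derivative of a density along y - x.\<close>
  have BH: "shen_laplacian funk_metric sigma_BH b x = - 2" if x: "x \<in> disc" for x
    using lap[OF x has_derivative_const[of 1] sigma_BH_eq] by simp
  have HT: "shen_laplacian funk_metric sigma_HT b x
      = - 2 + 3 * (x \<bullet> y - (norm x)\<^sup>2) / (1 - (norm x)\<^sup>2)" if x: "x \<in> disc" for x
  proof -
    have s: "1 - x \<bullet> x > 0" using disc_gap_pos[OF x] by (simp add: power2_norm_eq_inner)
    have "((\<lambda>z. 1 - z \<bullet> z) has_derivative (\<lambda>h. - 2 * (x \<bullet> h))) (at x)"
      by (auto intro!: derivative_eq_intros simp: inner_commute)
    from has_derivative_powr_const[OF this, of "-3/2"] s
    have "((\<lambda>z. (1 - z \<bullet> z) powr (-3/2)) has_derivative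
        (\<lambda>h. 3 * (x \<bullet> h) / (1 - x \<bullet> x) * (1 - x \<bullet> x) powr (-3/2))) (at x)"
      by simp
    from lap[OF x this, of sigma_HT] s show ?thesis
      by (simp add: sigma_HT_def sigma_alpha_eq power2_norm_eq_inner inner_diff_right)
  qed
  \<comment> \<open>The value c = 1 gives the maximum density and c = -1 the minimum one. The origin
    is excluded because the norm is differentiated.\<close>
  have quot: "((\<lambda>z. ((1 + c * norm z) / (1 - c * norm z)) powr (3/2)) has_derivative
      (\<lambda>h. 3 * c * (x \<bullet> h) / (norm x * (1 - (norm x)\<^sup>2))
        * ((1 + c * norm x) / (1 - c * norm x)) powr (3/2))) (at x)"
    and quot_pos: "(1 + c * norm x) / (1 - c * norm x) > 0"
    if x: "x \<in> disc - {0}" and c: "c = 1 \<or> c = -1" for x :: "real^2" and c :: real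
  proof -
    have x0: "x \<noteq> 0" and n: "norm x > 0" "norm x < 1" using x by auto
    have "\<bar>c * norm x\<bar> < 1" using c n(2) by auto
    then have p: "1 + c * norm x > 0" "1 - c * norm x > 0" by linarith+
    show q: "(1 + c * norm x) / (1 - c * norm x) > 0" using p by simp
    have f: "1 - (norm x)\<^sup>2 = (1 + c * norm x) * (1 - c * norm x)"
      using c by (auto simp: power2_eq_square algebra_simps)
    \<comment> \<open>This puts the chain rule output in the stated form, with l = 1 + c |x|, m = 1
      - c |x|, n = |x| and k = <x,h>; the product l m is 1 - |x|^2 because c^2 = 1.\<close>
    have e: "3/2 * (2 * c * k / (n * m\<^sup>2)) / (l / m) = 3 * c * k / (n * (l * m))"
      if "l > 0" "m > 0" "n > 0" for k l m n :: real
      using that by (simp add: field_simps power2_eq_square)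
    have "((\<lambda>z. (1 + c * norm z) / (1 - c * norm z)) has_derivative
        (\<lambda>h. 2 * c * (x \<bullet> h) / (norm x * (1 - c * norm x)\<^sup>2))) (at x)"
      using p n by (auto intro!: derivative_eq_intros has_derivative_norm_inner[OF x0]
          simp: fun_eq_iff field_simps power2_eq_square)
    from has_derivative_powr_const[OF this q, of "3/2"]
    show "((\<lambda>z. ((1 + c * norm z) / (1 - c * norm z)) powr (3/2)) has_derivative
      (\<lambda>h. 3 * c * (x \<bullet> h) / (norm x * (1 - (norm x)\<^sup>2))
        * ((1 + c * norm x) / (1 - c * norm x)) powr (3/2))) (at x)"
      by (simp only: e[OF p n(1)] f)
  qed
  have quot_lap: "shen_laplacian funk_metric \<sigma> b x
      = - 2 + 3 * c * (x \<bullet> y - (norm x)\<^sup>2) / (norm x * (1 - (norm x)\<^sup>2))"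
    if x: "x \<in> disc - {0}" and c: "c = 1 \<or> c = -1"
      and \<sigma>: "\<And>z. z \<in> disc \<Longrightarrow> \<sigma> z = ((1 + c * norm z) / (1 - c * norm z)) powr (3/2)"
    for x c \<sigma>
  proof -
    have "1 + c * norm x \<noteq> 0 \<and> c * norm x \<noteq> 1" using quot_pos[OF x c] by auto
    then show ?thesis
      using lap[OF _ quot[OF x c], of \<sigma>] x \<sigma> by (simp add: xyx)
  qed
  have max: "shen_laplacian funk_metric sigma_max b x
      = - 2 + 3 * (x \<bullet> y - (norm x)\<^sup>2) / (norm x * (1 - (norm x)\<^sup>2))" if "x \<in> disc - {0}" for x
    using quot_lap[OF that, of 1 sigma_max] sigma_max_min_eq(1) by simp
  have min: "shen_laplacian funk_metric sigma_min b x
      = - 2 - 3 * (x \<bullet> y - (norm x)\<^sup>2) / (norm x * (1 - (norm x)\<^sup>2))" if "x \<in> disc - {0}" for x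
    using quot_lap[OF that, of "-1" sigma_min] sigma_max_min_eq(2)
    by (simp add: minus_divide_left)
  show ?thesis using BH HT max min by auto
qed

end
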